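(* Let $\mathbb P$ be a lattice with greatest element $1$ satisfying condition $\mathsf C^{\uparrow}_1$. Then $\mathsf S_{\mathrm{fin}}(\mathsf V_1,\mathsf V_1)$ holds if and only if Player I has no winning strategy in the game $\mathsf G_{\mathrm{fin}}(\mathsf V_1,\mathsf V_1)$.
   Context: For a lattice $\mathbb P$ with greatest element $1$, $\mathsf V_1$ denotes the family of all nonempty subsets of $\mathbb P$ whose supremum is $1$. Condition $\mathsf C^{\uparrow}_1$: whenever $(a_n)_{n\in\omega}$ is an increasing sequence in $\mathbb P$ (i.e. $a_n\le a_{n+1}$) with supremum $1$, then for every $x\in\mathbb P$ the supremum $\bigvee_{n\in\omega}(x\wedge a_n)$ exists and equals $x$. For a nonempty family $\mathcal B$ of nonempty subsets of a set $D$: $\mathsf S_{\mathrm{fin}}(\mathcal B,\mathcal B)$ asserts that for every sequence $(A_n)_{n\in\omega}$ in $\mathcal B$ there are finite sets $F_n\subseteq A_n$ with $\bigcup_{n\in\omega}F_n\in\mathcal B$. In the game $\mathsf G_{\mathrm{fin}}(\mathcal B,\mathcal B)$, in each inning $n\in\omega$ Player I chooses $A_n\in\mathcal B$ and then Player II chooses a finite subset $F_n\subseteq A_n$; Player II wins if $\bigcup_{n\in\omega}F_n\in\mathcal B$, otherwise Player I wins. A strategy is a function telling a player how to play based on the previous moves of the opponent. *)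

theory Defs
  imports Complex_Main "HOL-Library.Lub_Glb"
begin

text \<open>A lattice with greatest element is a type of class \<^class>\<open>bounded_lattice_top\<close>, its
  greatest element is \<^term>\<open>top\<close>. Suprema need not exist, so "the supremum of \<open>A\<close> exists and
  equals \<open>s\<close>" is rendered by the relation \<open>isLub UNIV A s\<close>.\<close>

definition V1 :: "'a::bounded_lattice_top set set" where
  "V1 = {A. A \<noteq> {} \<and> isLub UNIV A top}"

definition C1_up :: "'a::bounded_lattice_top itself \<Rightarrow> bool" where
  "C1_up TYPE('a) \<longleftrightarrow>
     (\<forall>a :: nat \<Rightarrow> 'a. (\<forall>n. a n \<le> a (Suc n)) \<and> isLub UNIV (range a) top \<longrightarrow>
        (\<forall>x. isLub UNIV (range (\<lambda>n. inf x (a n))) x))"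

definition S_fin :: "'d set set \<Rightarrow> 'd set set \<Rightarrow> bool" where
  "S_fin \<A> \<B> \<longleftrightarrow>
     (\<forall>A :: nat \<Rightarrow> 'd set. (\<forall>n. A n \<in> \<A>) \<longrightarrow>
        (\<exists>F :: nat \<Rightarrow> 'd set. (\<forall>n. finite (F n) \<and> F n \<subseteq> A n) \<and> (\<Union>n. F n) \<in> \<B>))"

text \<open>A strategy of Player I in the game \<open>G_fin(\<A>, \<B>)\<close> maps the list \<open>[F\<^sub>0, \<dots>, F\<^sub>n\<^sub>-\<^sub>1]\<close> of the
  previous moves of Player II, in chronological order, to the move of Player I in inning \<open>n\<close>.
  Its values matter only on the lists which consist of legal answers of Player II to it.\<close>

definition legal_history :: "('d set list \<Rightarrow> 'd set) \<Rightarrow> 'd set list \<Rightarrow> bool" where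
  "legal_history \<sigma> h \<longleftrightarrow> (\<forall>i < length h. finite (h ! i) \<and> h ! i \<subseteq> \<sigma> (take i h))"

definition strategy_I :: "'d set set \<Rightarrow> ('d set list \<Rightarrow> 'd set) \<Rightarrow> bool" where
  "strategy_I \<A> \<sigma> \<longleftrightarrow> (\<forall>h. legal_history \<sigma> h \<longrightarrow> \<sigma> h \<in> \<A>)"

definition winning_strategy_I ::
    "'d set set \<Rightarrow> 'd set set \<Rightarrow> ('d set list \<Rightarrow> 'd set) \<Rightarrow> bool" where
  "winning_strategy_I \<A> \<B> \<sigma> \<longleftrightarrow> strategy_I \<A> \<sigma> \<and>
     (\<forall>F :: nat \<Rightarrow> 'd set.
        (\<forall>n. finite (F n) \<and> F n \<subseteq> \<sigma> (map F [0..<n])) \<longrightarrow> (\<Union>n. F n) \<notin> \<B>)"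

definition I_wins_G_fin :: "'d set set \<Rightarrow> 'd set set \<Rightarrow> bool" where
  "I_wins_G_fin \<A> \<B> \<longleftrightarrow> (\<exists>\<sigma>. winning_strategy_I \<A> \<B> \<sigma>)"

end

theory Submission
  imports Defs "HOL-Library.Countable_Set"
begin

text \<open>If \<open>S_fin V1 V1\<close> fails for a sequence \<open>A\<close>, then Player I wins by playing \<open>A n\<close> in inning \<open>n\<close>,
  whatever Player II does.

  The converse follows Hurewicz's argument for the Menger game. Let \<open>\<sigma>\<close> be a strategy of Player I.
  By \<open>S_fin V1 V1\<close> every member of \<open>V1\<close> has a countable subset in \<open>V1\<close>, so Player II may fix an
  enumeration of such a subset of each move of Player I and answer with initial segments of it only.
  The plays of this kind form the tree of finite sequences \<open>s\<close> of natural numbers. Let \<open>U s k\<close> be the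
  join of everything that Player II has chosen when the innings are answered by \<open>s\<close> and then by \<open>k\<close>.
  Each \<open>U s\<close> is increasing with supremum \<open>top\<close>, and \<open>U s k \<le> U (s @ [k]) m\<close>.

  Fix \<open>n\<close> and \<open>k\<close>. The elements \<open>U s k\<close> with \<open>length s \<le> n\<close> have a lower bound \<open>tree_meet U n [] k\<close>
  that is a meet of finitely many of them: if some entry of \<open>s\<close> is at least \<open>k\<close>, then cutting \<open>s\<close>
  at that entry does not increase \<open>U s k\<close>. Condition \<open>C1_up\<close> says that meeting with \<open>x\<close> preserves an
  increasing supremum \<open>top\<close>; hence finite meets of increasing sequences with supremum \<open>top\<close> again
  have supremum \<open>top\<close>, and so does \<open>tree_meet U n []\<close> (\<open>tree_meet_exhausts\<close>). Now \<open>S_fin V1 V1\<close>,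
  applied to the ranges of \<open>tree_meet U n []\<close>, yields numbers \<open>f n\<close> such that the elements
  \<open>tree_meet U n [] (f n)\<close> have supremum \<open>top\<close>. As \<open>tree_meet U n [] (f n)\<close> lies below
  \<open>U [f 0, \<dots>, f (n - 1)] (f n)\<close>, Player II defeats \<open>\<sigma>\<close> by following the branch \<open>f\<close>.\<close>

section \<open>Increasing sequences with supremum top\<close>

lemma isLub_top_iff:
  fixes A :: "'a::bounded_lattice_top set"
  shows "isLub UNIV A top \<longleftrightarrow> (\<forall>b. (\<forall>a\<in>A. a \<le> b) \<longrightarrow> b = top)"
  by (auto simp: isLub_def leastP_def isUb_def setle_def setge_def top_unique)

text \<open>An exhausting sequence is an increasing one with supremum \<open>top\<close>, that is, a sequence to
  which condition \<open>C1_up\<close> applies.\<close>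

definition exhausting :: "(nat \<Rightarrow> 'a::bounded_lattice_top) \<Rightarrow> bool" where
  "exhausting a \<longleftrightarrow> mono a \<and> isLub UNIV (range a) top"

lemma exhausting_mono: "exhausting a \<Longrightarrow> i \<le> j \<Longrightarrow> a i \<le> a j"
  by (auto simp: exhausting_def mono_def)

lemma exhausting_top: "exhausting a \<Longrightarrow> (\<And>k. a k \<le> b) \<Longrightarrow> b = top"
  by (auto simp: exhausting_def isLub_top_iff)

lemma exhaustingI:
  assumes "\<And>i j. i \<le> j \<Longrightarrow> a i \<le> a j" and "\<And>b. (\<And>k. a k \<le> b) \<Longrightarrow> b = top"
  shows "exhausting a"
  using assms by (auto simp: exhausting_def mono_def isLub_top_iff)

lemma exhausting_range_V1: "exhausting a \<Longrightarrow> range a \<in> V1"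
  by (simp add: exhausting_def V1_def)

lemma C1_up_inf_le:
  fixes x :: "'a::bounded_lattice_top"
  assumes "C1_up TYPE('a)" and "exhausting a" and "\<And>k. inf x (a k) \<le> b"
  shows "x \<le> b"
proof -
  have "isLub UNIV (range (\<lambda>n. inf x (a n))) x"
    using assms(1,2) by (auto simp: C1_up_def exhausting_def mono_def)
  then show ?thesis
    using assms(3) by (auto simp: isLub_def leastP_def isUb_def setle_def setge_def)
qed

lemma exhausting_inf:
  fixes a c :: "nat \<Rightarrow> 'a::bounded_lattice_top"
  assumes C: "C1_up TYPE('a)" and a: "exhausting a" and c: "exhausting c"
  shows "exhausting (\<lambda>k. inf (a k) (c k))"
proof (rule exhaustingI)
  show "inf (a i) (c i) \<le> inf (a j) (c j)" if "i \<le> j" for i j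
    using that by (intro inf_mono exhausting_mono[OF a] exhausting_mono[OF c])
next
  fix b assume b: "\<And>k. inf (a k) (c k) \<le> b"
  have "inf (a j) (c k) \<le> b" for j k
  proof -
    have "inf (a j) (c k) \<le> inf (a (max j k)) (c (max j k))"
      by (intro inf_mono exhausting_mono[OF a] exhausting_mono[OF c]) auto
    then show ?thesis using b order_trans by blast
  qed
  then have "a j \<le> b" for j
    by (rule C1_up_inf_le[OF C c])
  then show "b = top" by (rule exhausting_top[OF a])
qed

lemma exhausting_common_lower_bound:
  fixes a :: "'i \<Rightarrow> nat \<Rightarrow> 'a::bounded_lattice_top"
  assumes C: "C1_up TYPE('a)" and "finite I" and "\<And>i. i \<in> I \<Longrightarrow> exhausting (a i)"
  obtains c where "exhausting c" and "\<And>i k. i \<in> I \<Longrightarrow> c k \<le> a i k"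
proof -
  have "\<exists>c. exhausting c \<and> (\<forall>i\<in>I. \<forall>k. c k \<le> a i k)"
    using assms(2,3)
  proof (induction I rule: finite_induct)
    case empty
    have "exhausting (\<lambda>_. top :: 'a)"
      by (rule exhaustingI) (auto simp: top_unique)
    then show ?case by blast
  next
    case (insert j I)
    then obtain c where "exhausting c" "\<forall>i\<in>I. \<forall>k. c k \<le> a i k" by blast
    moreover have "exhausting (a j)" using insert.prems by blast
    ultimately show ?case
      using exhausting_inf[OF C, of "a j" c]
      by (intro exI[of _ "\<lambda>k. inf (a j k) (c k)"]) (auto intro: le_infI2)
  qed
  then show ?thesis using that by blast
qed

section \<open>Trees of exhausting sequences\<close>

text \<open>A meet of finitely many of the elements \<open>U (s @ t) k\<close> with \<open>length t \<le> n\<close>, namely of those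
  for which all entries of \<open>t\<close> are less than \<open>k\<close>.\<close>

primrec tree_meet :: "(nat list \<Rightarrow> nat \<Rightarrow> 'a::lattice) \<Rightarrow> nat \<Rightarrow> nat list \<Rightarrow> nat \<Rightarrow> 'a" where
  "tree_meet U 0 s k = U s k"
| "tree_meet U (Suc n) s k =
     Inf_fin (insert (U s k) ((\<lambda>i. tree_meet U n (s @ [i]) k) ` {..<k}))"

lemma le_tree_meet_Suc_iff:
  "x \<le> tree_meet U (Suc n) s k \<longleftrightarrow>
     x \<le> U s k \<and> (\<forall>i<k. x \<le> tree_meet U n (s @ [i]) k)"
  by (subst tree_meet.simps, subst Inf_fin.bounded_iff) auto

lemma tree_meet_le: "tree_meet U n s k \<le> U s k"
  using le_tree_meet_Suc_iff[of "tree_meet U n s k"] by (cases n) auto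

text \<open>A node \<open>s\<close> of the tree carries the exhausting sequence \<open>U s\<close>, and \<open>U s k\<close> lies below the whole
  sequence of the child \<open>s @ [k]\<close>. Hence for \<open>i \<ge> k\<close> everything above the child \<open>s @ [i]\<close> is
  at least \<open>U s k\<close>, and such children may be left out of a meet that contains \<open>U s k\<close>.\<close>

definition increasing_tree :: "(nat list \<Rightarrow> nat \<Rightarrow> 'a::bounded_lattice_top) \<Rightarrow> bool" where
  "increasing_tree U \<longleftrightarrow> (\<forall>s. exhausting (U s)) \<and> (\<forall>s k m. U s k \<le> U (s @ [k]) m)"

lemma increasing_tree_above:
  assumes U: "increasing_tree U" and "x \<le> U s 0"
  shows "x \<le> U (s @ t) k"
  using assms(2)
proof (induction t arbitrary: s k)
  case Nil
  then show ?case
    using U exhausting_mono[of "U s" 0 k] by (auto simp: increasing_tree_def intro: order_trans)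
next
  case (Cons i t)
  have "U s 0 \<le> U s i" "U s i \<le> U (s @ [i]) 0"
    using U exhausting_mono[of "U s" 0 i] by (auto simp: increasing_tree_def)
  with Cons.prems have "x \<le> U (s @ [i]) 0" by (meson order_trans)
  from Cons.IH[OF this] show ?case by simp
qed

lemma tree_meet_above:
  assumes U: "increasing_tree U" and "x \<le> U s 0"
  shows "x \<le> tree_meet U n s k"
  using assms(2)
proof (induction n arbitrary: s)
  case 0
  then show ?case using increasing_tree_above[OF U, of x s "[]"] by simp
next
  case (Suc n)
  have "x \<le> U (s @ [i]) 0" for i
    using increasing_tree_above[OF U Suc.prems] .
  then show ?case
    using Suc.IH increasing_tree_above[OF U Suc.prems, of "[]"]
    by (simp add: le_tree_meet_Suc_iff del: tree_meet.simps)
qed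

lemma increasing_tree_large_child:
  assumes U: "increasing_tree U" and "k \<le> i"
  shows "U s k \<le> U (s @ [i]) 0"
proof -
  have "U s k \<le> U s i" "U s i \<le> U (s @ [i]) 0"
    using U exhausting_mono[of "U s" k i] \<open>k \<le> i\<close> by (auto simp: increasing_tree_def)
  then show ?thesis by (rule order_trans)
qed

text \<open>Although \<open>tree_meet\<close> is a finite meet, it bounds the elements of all nodes up to level \<open>n\<close>
  above \<open>s\<close>, including those with entries that are at least \<open>k\<close>.\<close>

lemma tree_meet_le_node:
  assumes U: "increasing_tree U" and "length t \<le> n"
  shows "tree_meet U n s k \<le> U (s @ t) k"
  using assms(2)
proof (induction t arbitrary: s n)
  case Nil
  then show ?case by (simp add: tree_meet_le)
next
  case (Cons i t)
  then obtain m where n: "n = Suc m" and t: "length t \<le> m" by (cases n) auto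
  show ?case
  proof (cases "i < k")
    case True
    have "tree_meet U n s k \<le> tree_meet U m (s @ [i]) k"
      using le_tree_meet_Suc_iff[of "tree_meet U n s k" U m s k] True n by blast
    also have "\<dots> \<le> U ((s @ [i]) @ t) k" using Cons.IH[OF t] .
    finally show ?thesis by simp
  next
    case False
    have "tree_meet U n s k \<le> U s k" by (rule tree_meet_le)
    also have "\<dots> \<le> U (s @ [i]) 0"
      using increasing_tree_large_child[OF U] False by simp
    finally show ?thesis
      using increasing_tree_above[OF U, of _ "s @ [i]" t k] by simp
  qed
qed

text \<open>To see that an upper bound \<open>b\<close> of \<open>tree_meet U (Suc n) s\<close> is \<open>top\<close>, it suffices that
  \<open>U s j \<le> b\<close> for every \<open>j\<close>. With \<open>j\<close> fixed, \<open>U s j\<close> is met with the finitely many exhausting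
  sequences of the children \<open>i < j\<close>, and \<open>C1_up\<close> applies.\<close>

lemma tree_meet_exhausts:
  fixes U :: "nat list \<Rightarrow> nat \<Rightarrow> 'a::bounded_lattice_top"
  assumes C: "C1_up TYPE('a)" and U: "increasing_tree U"
  shows "exhausting (tree_meet U n s)"
proof (induction n arbitrary: s)
  case 0
  have "tree_meet U 0 s = U s" by (rule ext) simp
  then show ?case using U by (simp add: increasing_tree_def)
next
  case (Suc n)
  have Us: "exhausting (U s)" using U by (simp add: increasing_tree_def)
  have large: "U s j \<le> tree_meet U n (s @ [i]) k" if "j \<le> i" for i j k
    using tree_meet_above[OF U increasing_tree_large_child[OF U that]] .
  show ?case
  proof (rule exhaustingI)
    fix j k :: nat assume jk: "j \<le> k"
    have "tree_meet U (Suc n) s j \<le> tree_meet U n (s @ [i]) k" for i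
    proof (cases "i < j")
      case True
      then have "tree_meet U (Suc n) s j \<le> tree_meet U n (s @ [i]) j"
        using le_tree_meet_Suc_iff[of "tree_meet U (Suc n) s j" U n s j] by blast
      also have "\<dots> \<le> tree_meet U n (s @ [i]) k"
        by (rule exhausting_mono[OF Suc.IH jk])
      finally show ?thesis .
    next
      case False
      then have "U s j \<le> tree_meet U n (s @ [i]) k" by (intro large) simp
      then show ?thesis by (rule order_trans[OF tree_meet_le])
    qed
    moreover have "tree_meet U (Suc n) s j \<le> U s k"
      by (rule order_trans[OF tree_meet_le]) (rule exhausting_mono[OF Us jk])
    ultimately show "tree_meet U (Suc n) s j \<le> tree_meet U (Suc n) s k"
      by (simp only: le_tree_meet_Suc_iff) blast
  next
    fix b assume b: "\<And>k. tree_meet U (Suc n) s k \<le> b"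
    have "U s j \<le> b" for j
    proof -
      obtain c where c: "exhausting c"
        and c_le: "\<And>i k. i \<in> {..<j} \<Longrightarrow> c k \<le> tree_meet U n (s @ [i]) k"
        using exhausting_common_lower_bound[OF C, of "{..<j}" "\<lambda>i. tree_meet U n (s @ [i])"] Suc.IH
        by blast
      have "inf (U s j) (c k) \<le> b" for k
      proof -
        let ?m = "max j k"
        have "inf (U s j) (c k) \<le> tree_meet U n (s @ [i]) ?m" for i
        proof (cases "i < j")
          case True
          then have "c ?m \<le> tree_meet U n (s @ [i]) ?m" using c_le by simp
          moreover have "c k \<le> c ?m" using exhausting_mono[OF c] by simp
          ultimately show ?thesis by (meson le_infI2 order_trans)
        next
          case False
          then show ?thesis using large by (simp add: le_infI1)
        qed
        moreover have "inf (U s j) (c k) \<le> U s ?m"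
          using exhausting_mono[OF Us, of j ?m] by (simp add: le_infI1)
        ultimately have "inf (U s j) (c k) \<le> tree_meet U (Suc n) s ?m"
          by (simp only: le_tree_meet_Suc_iff) blast
        then show ?thesis using b order_trans by blast
      qed
      then show ?thesis by (rule C1_up_inf_le[OF C c])
    qed
    then show "b = top" by (rule exhausting_top[OF Us])
  qed
qed

text \<open>Here \<open>S_fin V1 V1\<close> selects finitely many elements of each range; as the sequences increase,
  one index \<open>f n\<close> dominates the selection in step \<open>n\<close>.\<close>

lemma exhausting_branch:
  fixes U :: "nat list \<Rightarrow> nat \<Rightarrow> 'a::bounded_lattice_top"
  assumes C: "C1_up TYPE('a)" and S: "S_fin (V1 :: 'a set set) V1" and U: "increasing_tree U"
  obtains f where "isLub UNIV (range (\<lambda>n. U (map f [0..<n]) (f n))) top"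
proof -
  let ?w = "\<lambda>n. tree_meet U n []"
  have w: "exhausting (?w n)" for n
    by (rule tree_meet_exhausts[OF C U])
  obtain F where F: "\<And>n. finite (F n) \<and> F n \<subseteq> range (?w n)" and FV: "(\<Union>n. F n) \<in> V1"
    using S[unfolded S_fin_def, THEN spec, of "\<lambda>n. range (?w n)"] exhausting_range_V1[OF w]
    by auto
  have "\<exists>m. \<forall>x\<in>F n. x \<le> ?w n m" for n
  proof -
    obtain K where K: "finite K" "F n = ?w n ` K"
      using F[of n] by (meson finite_subset_image)
    obtain m where m: "\<forall>k\<in>K. k \<le> m"
      using K(1) by (auto simp: finite_nat_set_iff_bounded_le)
    have "?w n k \<le> ?w n m" if "k \<in> K" for k
      by (rule exhausting_mono[OF w]) (use m that in blast)
    then show ?thesis unfolding K(2) by blast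
  qed
  then obtain f where f: "\<And>n x. x \<in> F n \<Longrightarrow> x \<le> ?w n (f n)" by metis
  have "b = top" if b: "\<And>n. U (map f [0..<n]) (f n) \<le> b" for b
  proof -
    have "x \<le> b" if "x \<in> F n" for x n
    proof -
      have "x \<le> ?w n (f n)" using f that .
      also have "\<dots> \<le> U ([] @ map f [0..<n]) (f n)"
        by (rule tree_meet_le_node[OF U]) simp
      also have "\<dots> \<le> b" using b by simp
      finally show ?thesis .
    qed
    then show ?thesis using FV by (auto simp: V1_def isLub_top_iff)
  qed
  then show ?thesis by (intro that[of f]) (auto simp: isLub_top_iff)
qed

section \<open>The game\<close>

lemma S_fin_V1_enumeration:
  fixes A :: "'a::bounded_lattice_top set"
  assumes S: "S_fin (V1 :: 'a set set) V1" and A: "A \<in> V1"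
  shows "\<exists>e :: nat \<Rightarrow> 'a. range e \<subseteq> A \<and> isLub UNIV (range e) top"
proof -
  obtain F :: "nat \<Rightarrow> 'a set" where F: "\<And>n. finite (F n) \<and> F n \<subseteq> A" and FV: "(\<Union>n. F n) \<in> V1"
    using S[unfolded S_fin_def, rule_format, of "\<lambda>_. A"] A by blast
  have "countable (\<Union>n. F n)" using F by (simp add: countable_finite)
  moreover have "(\<Union>n. F n) \<noteq> {}" and "isLub UNIV (\<Union>n. F n) top"
    using FV by (simp_all add: V1_def)
  ultimately have "range (from_nat_into (\<Union>n. F n)) = (\<Union>n. F n)"
    by simp
  then show ?thesis using F \<open>isLub UNIV (\<Union>n. F n) top\<close>
    by (intro exI[of _ "from_nat_into (\<Union>n. F n)"]) auto
qed

text \<open>The moves of Player II who, after the history \<open>h\<close>, answers \<open>k\<close> by the initial segment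
  \<open>e h 0, \<dots>, e h k\<close> of the enumeration \<open>e h\<close>.\<close>

definition segment_play :: "('d set list \<Rightarrow> nat \<Rightarrow> 'd) \<Rightarrow> nat list \<Rightarrow> 'd set list" where
  "segment_play e s = foldl (\<lambda>h k. h @ [e h ` {..k}]) [] s"

lemma segment_play_Nil [simp]: "segment_play e [] = []"
  by (simp add: segment_play_def)

lemma segment_play_snoc [simp]:
  "segment_play e (s @ [k]) = segment_play e s @ [e (segment_play e s) ` {..k}]"
  by (simp add: segment_play_def)

lemma finite_segment_play: "finite (\<Union> (set (segment_play e s)))"
  by (induction s rule: rev_induct) auto

lemma segment_play_branch:
  "segment_play e (map f [0..<n]) =
     map (\<lambda>i. e (segment_play e (map f [0..<i])) ` {..f i}) [0..<n]"
  by (induction n) auto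

lemma legal_history_snoc:
  assumes "legal_history \<sigma> h" and "finite F" and "F \<subseteq> \<sigma> h"
  shows "legal_history \<sigma> (h @ [F])"
  using assms by (auto simp: legal_history_def nth_append less_Suc_eq)

lemma legal_segment_play:
  assumes "\<And>h. legal_history \<sigma> h \<Longrightarrow> range (e h) \<subseteq> \<sigma> h"
  shows "legal_history \<sigma> (segment_play e s)"
proof (induction s rule: rev_induct)
  case Nil
  show ?case by (simp add: legal_history_def)
next
  case (snoc k s)
  then show ?case using assms[OF snoc.IH] by (auto intro!: legal_history_snoc)
qed

lemma S_fin_V1_imp_not_winning:
  fixes \<sigma> :: "'a::bounded_lattice_top set list \<Rightarrow> 'a set"
  assumes C: "C1_up TYPE('a)" and S: "S_fin (V1 :: 'a set set) V1"
  shows "\<not> winning_strategy_I V1 V1 \<sigma>"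
proof
  assume win: "winning_strategy_I V1 V1 \<sigma>"
  have "\<exists>e :: nat \<Rightarrow> 'a. legal_history \<sigma> h \<longrightarrow> range e \<subseteq> \<sigma> h \<and> isLub UNIV (range e) top" for h
    using win S_fin_V1_enumeration[OF S, of "\<sigma> h"]
    by (auto simp: winning_strategy_I_def strategy_I_def)
  then obtain e :: "'a set list \<Rightarrow> nat \<Rightarrow> 'a"
    where e: "\<And>h. legal_history \<sigma> h \<Longrightarrow> range (e h) \<subseteq> \<sigma> h"
      and e_lub: "\<And>h. legal_history \<sigma> h \<Longrightarrow> isLub UNIV (range (e h)) top"
    by metis
  let ?h = "segment_play e"
  have legal: "legal_history \<sigma> (?h s)" for s
    by (rule legal_segment_play[OF e])
  \<comment> \<open>Joining all previous moves, not only the last one, makes \<open>U\<close> increase along branches.\<close>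
  define U where "U s k = Sup_fin (\<Union> (set (?h (s @ [k]))))" for s k
  have U_le_iff: "U s k \<le> b \<longleftrightarrow> (\<forall>x \<in> \<Union> (set (?h (s @ [k]))). x \<le> b)" for s k b
    unfolding U_def by (rule Sup_fin.bounded_iff[OF finite_segment_play]) auto
  have U_ge: "x \<le> U s k" if "x \<in> \<Union> (set (?h (s @ [k])))" for x s k
    using that U_le_iff[of s k "U s k"] by blast
  have "increasing_tree U"
    unfolding increasing_tree_def
  proof (intro allI conjI)
    fix s
    show "exhausting (U s)"
    proof (rule exhaustingI)
      show "U s i \<le> U s j" if "i \<le> j" for i j
        unfolding U_le_iff using that by (intro ballI U_ge) fastforce
    next
      fix b assume "\<And>k. U s k \<le> b"
      then have "e (?h s) k \<le> b" for k
        using U_ge[of "e (?h s) k" s k] by (auto intro: order_trans)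
      then show "b = top" using e_lub[OF legal[of s]] by (auto simp: isLub_top_iff)
    qed
  next
    show "U s k \<le> U (s @ [k]) m" for s k m
      unfolding U_le_iff
      by (intro ballI U_ge) (subst segment_play_snoc, auto)
  qed
  then obtain f where f: "isLub UNIV (range (\<lambda>n. U (map f [0..<n]) (f n))) top"
    by (rule exhausting_branch[OF C S])
  define F where "F n = e (?h (map f [0..<n])) ` {..f n}" for n
  have h: "?h (map f [0..<n]) = map F [0..<n]" for n
    unfolding F_def by (rule segment_play_branch)
  have "finite (F n) \<and> F n \<subseteq> \<sigma> (map F [0..<n])" for n
    using e[OF legal[of "map f [0..<n]"]] unfolding h[symmetric] by (auto simp: F_def)
  moreover have "(\<Union>n. F n) \<in> V1"
  proof -
    have "b = top" if b: "\<forall>x\<in>(\<Union>n. F n). x \<le> b" for b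
    proof -
      have "U (map f [0..<n]) (f n) \<le> b" for n
      proof -
        have "?h (map f [0..<n] @ [f n]) = map F [0..<Suc n]"
          using h[of "Suc n"] by (simp del: segment_play_snoc)
        then have "\<Union> (set (?h (map f [0..<n] @ [f n]))) \<subseteq> (\<Union>n. F n)"
          by (simp only:) auto
        then show ?thesis unfolding U_le_iff using b by blast
      qed
      then show ?thesis using f by (auto simp: isLub_top_iff)
    qed
    moreover have "(\<Union>n. F n) \<noteq> {}" by (auto simp: F_def)
    ultimately show ?thesis by (simp add: V1_def isLub_top_iff)
  qed
  ultimately show False using win by (auto simp: winning_strategy_I_def)
qed

lemma not_I_wins_imp_S_fin:
  fixes \<A> \<B> :: "'d set set"
  assumes "\<not> I_wins_G_fin \<A> \<B>"
  shows "S_fin \<A> \<B>"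
  unfolding S_fin_def
proof (intro allI impI)
  fix A :: "nat \<Rightarrow> 'd set" assume "\<forall>n. A n \<in> \<A>"
  then have "strategy_I \<A> (\<lambda>h. A (length h))" by (simp add: strategy_I_def)
  moreover have "\<not> winning_strategy_I \<A> \<B> (\<lambda>h. A (length h))"
    using assms by (auto simp: I_wins_G_fin_def)
  ultimately show "\<exists>F. (\<forall>n. finite (F n) \<and> F n \<subseteq> A n) \<and> (\<Union>n. F n) \<in> \<B>"
    by (auto simp: winning_strategy_I_def)
qed

theorem theorem3p2:
  assumes "C1_up TYPE('a::bounded_lattice_top)"
  shows "S_fin (V1 :: 'a set set) V1 \<longleftrightarrow> \<not> I_wins_G_fin (V1 :: 'a set set) V1"
  using S_fin_V1_imp_not_winning[OF assms] not_I_wins_imp_S_fin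
  unfolding I_wins_G_fin_def by blast

end
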